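(* There exist $n\ge1$, a bounded open set $\Omega\subset\mathbb{R}^n$ with $C^{1,\gamma}$-boundary (for some $\gamma\in(0,1)$), and a set $E\subseteq\mathbb{R}^n$ with $C^\infty$-boundary, for which neither of the two limits $$\lim_{s\searrow0}s\,\mathrm{Per}_s(E;\Omega)\qquad\text{and}\qquad \lim_{s\searrow 0}\, s\int_{E\cap(\mathbb{R}^n\setminus B_1)}\frac{1}{|y|^{n+s}}\,dy$$ exists.
   Context: For $s\in(0,1)$ and measurable $A,B\subseteq\mathbb{R}^n$, set $L(A,B):=\int_A\int_B\frac{1}{|x-y|^{n+s}}\,dx\,dy\in[0,+\infty]$ (with $L(A,B)=0$ if $A$ or $B$ is empty). Write $\mathcal{C}E=\mathbb{R}^n\setminus E$. The $s$-perimeter of a measurable set $E\subseteq\mathbb{R}^n$ in $\Omega$ is $$\mathrm{Per}_s(E;\Omega):=L(E\cap\Omega,(\mathcal{C}E)\cap\Omega)+L(E\cap\Omega,(\mathcal{C}E)\cap(\mathcal{C}\Omega))+L(E\cap(\mathcal{C}\Omega),(\mathcal{C}E)\cap\Omega).$$ $B_1$ is the open unit ball centered at $0$. *)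

theory Defs
  imports "HOL-Analysis.Analysis"
begin

text \<open>
  The dimension \<open>n\<close> is existentially quantified in the theorem, so it cannot be a type.
  The space \<open>\<real>\<^sup>n\<close> is the set of extensional functions on \<open>{..<n}\<close>, which is also the underlying
  space of the library's product measure \<open>PiM {..<n} M\<close>.
\<close>

definition Rn :: "nat \<Rightarrow> (nat \<Rightarrow> real) set" where
  "Rn n = PiE {..<n} (\<lambda>_. UNIV)"

definition enorm :: "nat \<Rightarrow> (nat \<Rightarrow> real) \<Rightarrow> real" where
  "enorm n x = L2_set x {..<n}"

definition edist :: "nat \<Rightarrow> (nat \<Rightarrow> real) \<Rightarrow> (nat \<Rightarrow> real) \<Rightarrow> real" where
  "edist n x y = enorm n (\<lambda>i. x i - y i)"

lemma Metric_space_Rn: "Metric_space (Rn n) (edist n)"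
proof
  show "0 \<le> edist n x y" for x y
    by (simp add: edist_def enorm_def)
  show "edist n x y = edist n y x" for x y
    unfolding edist_def enorm_def L2_set_def by (simp add: power2_commute)
  show "(edist n x y = 0) = (x = y)" if "x \<in> Rn n" "y \<in> Rn n" for x y
    using that unfolding edist_def enorm_def Rn_def
    by (auto simp: L2_set_eq_0_iff intro: PiE_ext)
  show "edist n x z \<le> edist n x y + edist n y z" for x y z
    using L2_set_triangle_ineq[of "\<lambda>i. x i - y i" "\<lambda>i. y i - z i" "{..<n}"]
    by (simp add: edist_def enorm_def)
qed

interpretation Rn: Metric_space "Rn n" "edist n" for n
  by (rule Metric_space_Rn)

definition unit_ball :: "nat \<Rightarrow> (nat \<Rightarrow> real) set" where
  "unit_ball n = {x \<in> Rn n. enorm n x < 1}"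

text \<open>
  Lebesgue measure. It is completed because a set with smooth boundary may contain an arbitrary
  part of that boundary, so that it is Lebesgue measurable but not necessarily Borel.
\<close>

definition lebesgue_Rn :: "nat \<Rightarrow> (nat \<Rightarrow> real) measure" where
  "lebesgue_Rn n = completion (PiM {..<n} (\<lambda>_. lborel))"

definition interaction ::
    "nat \<Rightarrow> real \<Rightarrow> (nat \<Rightarrow> real) set \<Rightarrow> (nat \<Rightarrow> real) set \<Rightarrow> ennreal" where
  "interaction n s A B =
     (\<integral>\<^sup>+x\<in>A. (\<integral>\<^sup>+y\<in>B. ennreal (1 / edist n x y powr (real n + s)) \<partial>lebesgue_Rn n) \<partial>lebesgue_Rn n)"

definition Per ::
    "nat \<Rightarrow> real \<Rightarrow> (nat \<Rightarrow> real) set \<Rightarrow> (nat \<Rightarrow> real) set \<Rightarrow> ennreal" where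
  "Per n s E \<Omega> =
     interaction n s (E \<inter> \<Omega>) ((Rn n - E) \<inter> \<Omega>) +
     interaction n s (E \<inter> \<Omega>) ((Rn n - E) \<inter> (Rn n - \<Omega>)) +
     interaction n s (E \<inter> (Rn n - \<Omega>)) ((Rn n - E) \<inter> \<Omega>)"

definition partial_deriv ::
    "nat \<Rightarrow> ((nat \<Rightarrow> real) \<Rightarrow> real) \<Rightarrow> (nat \<Rightarrow> real) \<Rightarrow> real" where
  "partial_deriv i f x = deriv (\<lambda>t. f (x(i := t))) (x i)"

text \<open>The following two classes of functions are meant for sets \<open>U\<close> that are open in \<open>Rn n\<close>.\<close>

fun Ck_on :: "nat \<Rightarrow> nat \<Rightarrow> (nat \<Rightarrow> real) set \<Rightarrow> ((nat \<Rightarrow> real) \<Rightarrow> real) \<Rightarrow> bool" where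
  "Ck_on n 0 U f \<longleftrightarrow> continuous_map (subtopology (Rn.mtopology n) U) euclideanreal f"
| "Ck_on n (Suc k) U f \<longleftrightarrow>
     continuous_map (subtopology (Rn.mtopology n) U) euclideanreal f \<and>
     (\<forall>i<n. (\<forall>x\<in>U. (\<lambda>t. f (x(i := t))) differentiable (at (x i))) \<and>
            Ck_on n k U (partial_deriv i f))"

definition smooth_fun_on :: "nat \<Rightarrow> (nat \<Rightarrow> real) set \<Rightarrow> ((nat \<Rightarrow> real) \<Rightarrow> real) \<Rightarrow> bool" where
  "smooth_fun_on n U f \<longleftrightarrow> (\<forall>k. Ck_on n k U f)"

definition C1_holder_on ::
    "nat \<Rightarrow> real \<Rightarrow> (nat \<Rightarrow> real) set \<Rightarrow> ((nat \<Rightarrow> real) \<Rightarrow> real) \<Rightarrow> bool" where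
  "C1_holder_on n \<gamma> U f \<longleftrightarrow>
     Ck_on n 1 U f \<and>
     (\<forall>i<n. \<exists>K. \<forall>x\<in>U. \<forall>y\<in>U.
        \<bar>partial_deriv i f x - partial_deriv i f y\<bar> \<le> K * edist n x y powr \<gamma>)"

text \<open>
  Near each boundary point, up to the choice and orientation \<open>\<sigma>\<close> of one coordinate axis \<open>i\<close>, the set
  \<open>E\<close> is the region above the graph of a function \<open>g\<close> of the remaining \<open>n - 1\<close> coordinates with
  regularity \<open>\<C>\<close>. The function \<open>g\<close> is represented as a function on \<open>Rn n\<close> that does not depend on
  coordinate \<open>i\<close>; the projection of a ball along axis \<open>i\<close> is the \<open>(n - 1)\<close>-dimensional ball of the
  same radius, so regularity of \<open>g\<close> on either one is the same. Rotations of the axes are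
  not needed, by the implicit function theorem. The set \<open>E\<close> may or may not contain points of the
  graph itself; if it is open, it contains none of them.
\<close>

definition has_boundary_of_class ::
    "nat \<Rightarrow> ((nat \<Rightarrow> real) set \<Rightarrow> ((nat \<Rightarrow> real) \<Rightarrow> real) \<Rightarrow> bool) \<Rightarrow> (nat \<Rightarrow> real) set \<Rightarrow> bool" where
  "has_boundary_of_class n \<C> E \<longleftrightarrow>
     (\<forall>p \<in> Rn.mtopology n frontier_of E.
        \<exists>r>0. \<exists>i<n. \<exists>\<sigma>\<in>{-1, 1}. \<exists>g.
          \<C> (Rn.mball n p r) g \<and>
          (\<forall>x\<in>Rn n. \<forall>t. g (x(i := t)) = g x) \<and>
          (\<forall>x\<in>Rn.mball n p r.
             (\<sigma> * (x i - g x) > 0 \<longrightarrow> x \<in> E) \<and>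
             (\<sigma> * (x i - g x) < 0 \<longrightarrow> x \<notin> E)))"

definition has_smooth_boundary :: "nat \<Rightarrow> (nat \<Rightarrow> real) set \<Rightarrow> bool" where
  "has_smooth_boundary n = has_boundary_of_class n (smooth_fun_on n)"

definition has_C1_holder_boundary :: "nat \<Rightarrow> real \<Rightarrow> (nat \<Rightarrow> real) set \<Rightarrow> bool" where
  "has_C1_holder_boundary n \<gamma> = has_boundary_of_class n (C1_holder_on n \<gamma>)"

end

(* In dimension one, take for E the union of the intervals [c(2k), c(2k+1)] with c(m) = exp (10000^m).
   Since s times the integral of x^(-1-s) over [a, b] is a^(-s) - b^(-s), the weighted mass of E is
   at least 0.98 when s is midway (logarithmically) between 1/ln c(m) and 1/ln c(m+1) with m even,
   and at most 0.02 with m odd. For the interval (-1, 1), which is disjoint from E, the nonlocal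
   interaction with a point x >= 2 is between 1/2 and 8 times x^(-1-s), so the s-perimeter
   oscillates as well. *)
theory Submission imports Defs begin

section \<open>The lacunary set on the real line\<close>

definition lacunary_point :: "nat \<Rightarrow> real" where
  "lacunary_point m = exp (10000 ^ m)"

definition lacunary_set :: "real set" where
  "lacunary_set = (\<Union>k. {lacunary_point (2 * k)..lacunary_point (2 * k + 1)})"

lemma strict_mono_lacunary_point: "strict_mono lacunary_point"
  by (auto simp: strict_mono_def lacunary_point_def)

lemma lacunary_point_powr: "lacunary_point m powr s = exp (s * 10000 ^ m)"
  by (simp add: lacunary_point_def powr_def)

lemma lacunary_point_ge_2: "2 \<le> lacunary_point m"
proof -
  have "(1::real) \<le> 10000 ^ m" by simp
  then show ?thesis
    using exp_ge_add_one_self[of "10000 ^ m"] unfolding lacunary_point_def by linarith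
qed

lemma lacunary_set_ge_2: "x \<in> lacunary_set \<Longrightarrow> 2 \<le> x"
  using lacunary_point_ge_2 by (fastforce simp: lacunary_set_def intro: order_trans)

lemma lacunary_set_borel [measurable]: "lacunary_set \<in> sets borel"
  unfolding lacunary_set_def by auto

text \<open>The points are unbounded, so there is a least index whose point exceeds
  \<open>x\<close>. It is not 0 by the assumption, and its predecessor is the required
  \<open>m\<close>.\<close>

lemma lacunary_point_bracket:
  assumes "lacunary_point 0 \<le> x"
  obtains m where "lacunary_point m \<le> x" "x < lacunary_point (Suc m)"
proof -
  obtain k where "x < of_nat k" using reals_Archimedean2 by blast
  moreover have "of_nat k \<le> lacunary_point k"
  proof -
    have "real k \<le> 10000 ^ k"
      \<comment> \<open>With 10000 = 1 + 9999 the inequality gives \<open>1 + 9999 * k\<close> as a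
        lower bound of the power.\<close>
      using Bernoulli_inequality[of 9999 k] by simp
    then show ?thesis
      using exp_ge_add_one_self[of "10000 ^ k"] unfolding lacunary_point_def by linarith
  qed
  ultimately have ex: "\<exists>k. x < lacunary_point k"
    by (meson less_le_trans)
  define k where "k = (LEAST k. x < lacunary_point k)"
  have "x < lacunary_point k" unfolding k_def using ex by (rule LeastI_ex)
  moreover from this assms obtain m where m: "k = Suc m"
    by (cases k) auto
  moreover have "\<not> x < lacunary_point m"
    using not_less_Least[of m "\<lambda>k. x < lacunary_point k"] m unfolding k_def by simp
  ultimately show ?thesis using that[of m] by simp
qed

text \<open>Strict monotonicity turns membership in the interval of index \<open>k\<close> into
  \<open>2 * k < Suc m\<close> and \<open>m < 2 * k + 1\<close>, which forces
  \<open>m = 2 * k\<close>. Both inequalities on \<open>x\<close> are strict because the intervals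
  are closed: every point of the sequence lies in the set, also for odd \<open>m\<close>.\<close>

lemma lacunary_set_between:
  assumes "lacunary_point m < x" "x < lacunary_point (Suc m)"
  shows "x \<in> lacunary_set \<longleftrightarrow> even m"
proof
  assume "x \<in> lacunary_set"
  then obtain k where k: "lacunary_point (2 * k) \<le> x" "x \<le> lacunary_point (2 * k + 1)"
    by (auto simp: lacunary_set_def)
  then have "lacunary_point (2 * k) < lacunary_point (Suc m)"
    "lacunary_point m < lacunary_point (2 * k + 1)"
    using assms by linarith+
  then have "2 * k < Suc m" "m < 2 * k + 1"
    using strict_mono_less[OF strict_mono_lacunary_point] by blast+
  then have "m = 2 * k" by linarith
  then show "even m" by simp
next
  assume "even m"
  then obtain k where "m = 2 * k" by (rule evenE)
  then show "x \<in> lacunary_set"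
    using assms unfolding lacunary_set_def by (intro UN_I[of k]) auto
qed

lemma lacunary_set_below: "x < lacunary_point 0 \<Longrightarrow> x \<notin> lacunary_set"
  using strict_mono_less_eq[OF strict_mono_lacunary_point, of 0]
  by (auto simp: lacunary_set_def) (meson le_less_trans less_le_not_le)

text \<open>This is the form of local information that the boundary condition asks for. Away from
  the sequence a neighbourhood lies in a single gap; at a point of the sequence two gaps of opposite
  parity meet, and \<open>\<sigma>\<close> tells on which side the set lies.\<close>

lemma lacunary_set_local_structure:
  obtains
    (locally_const) r b where "r > 0" "\<And>x. \<bar>x - p\<bar> < r \<Longrightarrow> x \<in> lacunary_set \<longleftrightarrow> b"
  | (boundary) r \<sigma> where "r > 0" "\<sigma> \<in> {-1, 1::real}"
      "\<And>x. \<bar>x - p\<bar> < r \<Longrightarrow> (\<sigma> * (x - p) > 0 \<longrightarrow> x \<in> lacunary_set) \<and> (\<sigma> * (x - p) < 0 \<longrightarrow> x \<notin> lacunary_set)"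
proof (cases "p < lacunary_point 0")
  case True
  then show ?thesis
    by (intro locally_const[of "lacunary_point 0 - p" False]) (auto simp: lacunary_set_below)
next
  case False
  then obtain m where m: "lacunary_point m \<le> p" "p < lacunary_point (Suc m)"
    using lacunary_point_bracket by (metis not_less)
  show ?thesis
  proof (cases "p = lacunary_point m")
    case False
    show ?thesis
    proof (rule locally_const)
      show "0 < min (p - lacunary_point m) (lacunary_point (Suc m) - p)"
        using m False by auto
      show "x \<in> lacunary_set \<longleftrightarrow> even m"
        if "\<bar>x - p\<bar> < min (p - lacunary_point m) (lacunary_point (Suc m) - p)" for x
        using that by (intro lacunary_set_between) auto
    qed
  next
    case p: True
    \<comment> \<open>The gap to the left of \<open>p\<close> has index \<open>m - 1\<close>, hence
      the flipped parity. For \<open>m = 0\<close> everything to the left is outside the set, so any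
      radius works and 1 is taken.\<close>
    obtain r where r: "r > 0" "\<And>x. p - r < x \<Longrightarrow> x < p \<Longrightarrow> x \<in> lacunary_set \<longleftrightarrow> odd m"
    proof (cases m)
      case 0
      then show ?thesis using that[of 1] p by (auto simp: lacunary_set_below)
    next
      case (Suc k)
      then show ?thesis
        using that[of "p - lacunary_point k"] p lacunary_set_between[of k]
          strict_mono_less[OF strict_mono_lacunary_point, of k m]
        by auto
    qed
    show ?thesis
    proof (rule boundary)
      let ?r = "min r (lacunary_point (Suc m) - p)"
      let ?\<sigma> = "if even m then 1 else - 1 :: real"
      show "0 < ?r" using r m by auto
      show "?\<sigma> \<in> {-1, 1}" by auto
      fix x assume x: "\<bar>x - p\<bar> < ?r"
      have "x \<in> lacunary_set \<longleftrightarrow> odd m" if "x < p"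
        using that x r(2)[of x] by auto
      moreover have "x \<in> lacunary_set \<longleftrightarrow> even m" if "p < x"
        using that x p by (intro lacunary_set_between) auto
      ultimately show "(?\<sigma> * (x - p) > 0 \<longrightarrow> x \<in> lacunary_set) \<and> (?\<sigma> * (x - p) < 0 \<longrightarrow> x \<notin> lacunary_set)"
        by auto
    qed
  qed
qed

section \<open>Integrals of the power kernel and oscillation of the weighted mass\<close>

lemma has_real_derivative_inverse_powr:
  fixes s x :: real
  assumes "0 < x" "s \<noteq> 0"
  shows "((\<lambda>x. - (x powr (- s) / s)) has_real_derivative 1 / x powr (1 + s)) (at x)"
proof -
  have "((\<lambda>x. - (x powr (- s) / s)) has_real_derivative - ((- s * x powr (- s - 1)) / s)) (at x)"
    using assms by (intro DERIV_minus DERIV_cdivide has_real_derivative_powr)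
  moreover have "- ((- s * x powr (- s - 1)) / s) = 1 / x powr (1 + s)"
    using assms powr_minus_divide[of x "1 + s"] by (simp add: minus_diff_commute)
  ultimately show ?thesis by simp
qed

text \<open>The primitive vanishes at infinity because \<open>s > 0\<close>. The factor
  \<open>s\<close> in front cancels the division by \<open>s\<close> in the primitive, so the value
  stays bounded as \<open>s\<close> tends to 0.\<close>

lemma nn_integral_inverse_powr_Ici:
  fixes a s :: real
  assumes "0 < a" "0 < s"
  shows "ennreal s * (\<integral>\<^sup>+x\<in>{a..}. ennreal (1 / x powr (1 + s)) \<partial>lborel) = ennreal (a powr (- s))"
proof -
  have "(\<integral>\<^sup>+x\<in>{a..}. ennreal (1 / x powr (1 + s)) \<partial>lborel) = ennreal (0 - (- (a powr (- s) / s)))"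
  proof (rule nn_integral_FTC_atLeast)
    show "((\<lambda>x. - (x powr (- s) / s)) has_real_derivative 1 / x powr (1 + s)) (at x)" if "a \<le> x" for x
      using that assms by (intro has_real_derivative_inverse_powr) auto
    show "((\<lambda>x. - (x powr (- s) / s)) \<longlongrightarrow> 0) at_top"
      using tendsto_minus[OF tendsto_divide[OF tendsto_neg_powr[OF _ filterlim_ident, of "- s"] tendsto_const[of s]]]
        assms by simp
  qed (use assms in auto)
  then show ?thesis using assms by (simp flip: ennreal_mult')
qed

lemma nn_integral_inverse_powr_Icc:
  fixes a b s :: real
  assumes "0 < a" "a \<le> b" "0 < s"
  shows "ennreal s * (\<integral>\<^sup>+x\<in>{a..b}. ennreal (1 / x powr (1 + s)) \<partial>lborel) =
    ennreal (a powr (- s) - b powr (- s))"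
proof -
  have "(\<integral>\<^sup>+x\<in>{a..b}. ennreal (1 / x powr (1 + s)) \<partial>lborel) =
      ennreal (- (b powr (- s) / s) - (- (a powr (- s) / s)))"
  proof (rule nn_integral_FTC_Icc)
    show "((\<lambda>x. - (x powr (- s) / s)) has_real_derivative 1 / x powr (1 + s)) (at x)"
      if "x \<in> {a..b}" for x
      using that assms by (intro has_real_derivative_inverse_powr) auto
  qed (use assms in auto)
  then show ?thesis using assms by (simp flip: ennreal_mult' add: right_diff_distrib)
qed

text \<open>Both expressions of the theorem are reduced to this function of \<open>s\<close>: the
  weighted tail integral equals it, and the weighted perimeter lies between fixed multiples of
  it.\<close>

definition lacunary_mass :: "real \<Rightarrow> ennreal" where
  "lacunary_mass s = ennreal s * (\<integral>\<^sup>+x\<in>lacunary_set. ennreal (1 / x powr (1 + s)) \<partial>lborel)"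

text \<open>At these scales the points \<open>lacunary_point i\<close> with \<open>i \<le> m\<close> look like \<open>1\<close> and the others like \<open>\<infinity>\<close>.\<close>

definition lacunary_scale :: "nat \<Rightarrow> real" where
  "lacunary_scale m = 1 / (100 * 10000 ^ m)"

lemma lacunary_scale_pos: "0 < lacunary_scale m"
  by (simp add: lacunary_scale_def)

text \<open>The power is exactly \<open>exp (- 1 / 100)\<close>, and
  \<open>exp x \<ge> 1 + x\<close>.\<close>

lemma lacunary_scale_powr_lower: "99/100 \<le> lacunary_point m powr (- lacunary_scale m)"
  using exp_ge_add_one_self[of "- 1 / 100"] by (simp add: lacunary_point_powr lacunary_scale_def)

text \<open>Passing to the next point multiplies the exponent by 10000, from -1/100 to -100.\<close>

lemma lacunary_scale_powr_upper: "lacunary_point (Suc m) powr (- lacunary_scale m) \<le> 1/100"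
proof -
  have "lacunary_point (Suc m) powr (- lacunary_scale m) = inverse (exp 100)"
    by (simp add: lacunary_point_powr lacunary_scale_def flip: exp_minus)
  moreover have "(100::real) \<le> exp 100"
    using exp_ge_add_one_self[of 100] by simp
  ultimately show ?thesis
    using le_imp_inverse_le[of "100::real" "exp 100"] by simp
qed

text \<open>The single interval that starts at \<open>lacunary_point (2 * k)\<close> already carries
  mass at least 99/100 - 1/100.\<close>

lemma lacunary_mass_even: "ennreal (98/100) \<le> lacunary_mass (lacunary_scale (2 * k))"
proof -
  let ?s = "lacunary_scale (2 * k)"
  let ?a = "lacunary_point (2 * k)" and ?b = "lacunary_point (Suc (2 * k))"
  have "?a \<le> ?b"
    by (simp add: strict_mono_less_eq[OF strict_mono_lacunary_point])
  moreover have "0 < ?a" by (simp add: lacunary_point_def)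
  ultimately have "ennreal (?a powr (- ?s) - ?b powr (- ?s)) =
      ennreal ?s * (\<integral>\<^sup>+x\<in>{?a..?b}. ennreal (1 / x powr (1 + ?s)) \<partial>lborel)"
    using lacunary_scale_pos by (simp add: nn_integral_inverse_powr_Icc)
  also have "\<dots> \<le> lacunary_mass ?s"
    unfolding lacunary_mass_def lacunary_set_def
    by (intro mult_left_mono nn_integral_mono) (auto simp: indicator_def)
  finally show ?thesis
    using lacunary_scale_powr_lower[of "2 * k"] lacunary_scale_powr_upper[of "2 * k"]
    by (elim order_trans[rotated]) (simp add: ennreal_leI)
qed

text \<open>The gap after \<open>lacunary_point (2 * k + 1)\<close> is missing from the set. What
  lies before it weighs at most 1 - 99/100, and what lies after it at most 1/100.\<close>

lemma lacunary_mass_odd: "lacunary_mass (lacunary_scale (2 * k + 1)) \<le> ennreal (2/100)"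
proof -
  let ?s = "lacunary_scale (Suc (2 * k))"
  let ?b = "lacunary_point (Suc (2 * k))" and ?a = "lacunary_point (Suc (Suc (2 * k)))"
  let ?f = "\<lambda>x. ennreal (1 / x powr (1 + ?s))"
  \<comment> \<open>The left end 1 is below the whole set and makes the first power in the interval
    formula equal to 1.\<close>
  have "lacunary_set \<subseteq> {1..?b} \<union> {?a..}"
  proof
    fix x assume x: "x \<in> lacunary_set"
    then obtain j where j: "lacunary_point (2 * j) \<le> x" "x \<le> lacunary_point (2 * j + 1)"
      by (auto simp: lacunary_set_def)
    \<comment> \<open>The two alternatives are \<open>j \<le> k\<close> and
      \<open>j \<ge> k + 1\<close>.\<close>
    have "lacunary_point (2 * j + 1) \<le> ?b \<or> ?a \<le> lacunary_point (2 * j)"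
      by (simp add: strict_mono_less_eq[OF strict_mono_lacunary_point]) linarith
    then show "x \<in> {1..?b} \<union> {?a..}" using j lacunary_set_ge_2[OF x] by auto
  qed
  then have "lacunary_mass ?s \<le> ennreal ?s * (\<integral>\<^sup>+x. ?f x * indicator {1..?b} x + ?f x * indicator {?a..} x \<partial>lborel)"
    unfolding lacunary_mass_def
    by (intro mult_left_mono nn_integral_mono) (auto simp: indicator_def)
  also have "\<dots> = ennreal ?s * (\<integral>\<^sup>+x\<in>{1..?b}. ?f x \<partial>lborel) + ennreal ?s * (\<integral>\<^sup>+x\<in>{?a..}. ?f x \<partial>lborel)"
    by (subst nn_integral_add) (auto simp: distrib_left)
  also have "\<dots> = ennreal (1 - ?b powr (- ?s)) + ennreal (?a powr (- ?s))"
    using lacunary_point_ge_2[of "Suc (2 * k)"] lacunary_point_ge_2[of "Suc (Suc (2 * k))"] lacunary_scale_pos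
    by (simp add: nn_integral_inverse_powr_Icc nn_integral_inverse_powr_Ici)
  also have "\<dots> \<le> ennreal (1/100) + ennreal (1/100)"
    using lacunary_scale_powr_lower[of "Suc (2 * k)"] lacunary_scale_powr_upper[of "Suc (2 * k)"]
    by (intro add_mono ennreal_leI) auto
  also have "\<dots> = ennreal (2/100)"
    by (simp flip: ennreal_plus)
  finally show ?thesis by simp
qed

lemma filterlim_lacunary_scale: "filterlim lacunary_scale (at_right 0) sequentially"
proof -
  have "lacunary_scale = (\<lambda>m. 1 / 100 * inverse (10000 ^ m))"
    by (simp add: fun_eq_iff lacunary_scale_def field_simps)
  moreover have "(\<lambda>m. 1 / 100 * inverse (10000 ^ m) :: real) \<longlonglongrightarrow> 1 / 100 * 0"
    by (rule tendsto_mult[OF tendsto_const LIMSEQ_inverse_realpow_zero]) simp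
  ultimately have "lacunary_scale \<longlonglongrightarrow> 0"
    by simp
  moreover have "lacunary_scale m \<noteq> 0" for m
    using lacunary_scale_pos[of m] by simp
  ultimately show ?thesis
    using lacunary_scale_pos by (simp add: filterlim_at)
qed

text \<open>A limit would be at least 1/2 * 98/100 = 49/100 along the even scales and at most 8 *
  2/100 = 16/100 along the odd ones. The factors 1/2 and 8 are those of the interaction estimate. As
  \<open>l\<close> ranges over \<open>ennreal\<close>, an infinite limit is excluded too.\<close>

lemma not_convergent_if_comparable_lacunary_mass:
  fixes F :: "real \<Rightarrow> ennreal"
  assumes lower: "\<And>s. 0 < s \<Longrightarrow> s \<le> 1 \<Longrightarrow> ennreal (1/2) * lacunary_mass s \<le> F s"
    and upper: "\<And>s. 0 < s \<Longrightarrow> s \<le> 1 \<Longrightarrow> F s \<le> ennreal 8 * lacunary_mass s"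
  shows "\<not> (\<exists>l. (F \<longlongrightarrow> l) (at_right 0))"
proof
  assume "\<exists>l. (F \<longlongrightarrow> l) (at_right 0)"
  then obtain l where "(F \<longlongrightarrow> l) (at_right 0)" ..
  then have lim: "(\<lambda>m. F (lacunary_scale m)) \<longlonglongrightarrow> l"
    using filterlim_lacunary_scale by (rule filterlim_compose)
  have le_1: "lacunary_scale m \<le> 1" for m
  proof -
    have "(1::real) \<le> 10000 ^ m" by simp
    then have "(1::real) \<le> 100 * 10000 ^ m" by linarith
    then show ?thesis by (simp add: lacunary_scale_def)
  qed
  have even: "(\<lambda>k. F (lacunary_scale (2 * k))) \<longlonglongrightarrow> l"
    using LIMSEQ_subseq_LIMSEQ[OF lim, of "\<lambda>k. 2 * k"] by (simp add: o_def strict_mono_def)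
  have odd: "(\<lambda>k. F (lacunary_scale (2 * k + 1))) \<longlonglongrightarrow> l"
    using LIMSEQ_subseq_LIMSEQ[OF lim, of "\<lambda>k. 2 * k + 1"] by (simp add: o_def strict_mono_def)
  have "ennreal (49/100) \<le> F (lacunary_scale (2 * k))" for k
  proof -
    have "ennreal (49/100) = ennreal (1/2) * ennreal (98/100)"
      by (subst ennreal_mult[symmetric]) auto
    also have "\<dots> \<le> ennreal (1/2) * lacunary_mass (lacunary_scale (2 * k))"
      by (intro mult_left_mono lacunary_mass_even) auto
    also have "\<dots> \<le> F (lacunary_scale (2 * k))" by (intro lower lacunary_scale_pos le_1)
    finally show ?thesis .
  qed
  then have l: "ennreal (49/100) \<le> l"
    by (intro LIMSEQ_le_const[OF even]) blast
  have "F (lacunary_scale (2 * k + 1)) \<le> ennreal (16/100)" for k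
  proof -
    have "F (lacunary_scale (2 * k + 1)) \<le> ennreal 8 * lacunary_mass (lacunary_scale (2 * k + 1))"
      by (intro upper lacunary_scale_pos le_1)
    also have "\<dots> \<le> ennreal 8 * ennreal (2/100)"
      by (intro mult_left_mono lacunary_mass_odd) auto
    also have "\<dots> = ennreal (16/100)"
      by (subst ennreal_mult[symmetric]) auto
    finally show ?thesis .
  qed
  then have "l \<le> ennreal (16/100)"
    by (intro LIMSEQ_le_const2[OF odd]) blast
  with l have "ennreal (49/100) \<le> ennreal (16/100)" by (rule order_trans)
  then show False by (subst (asm) ennreal_le_iff) auto
qed

section \<open>Transfer of sets and integrals from the line to \<open>Rn 1\<close>\<close>

definition slice :: "real set \<Rightarrow> (nat \<Rightarrow> real) set" where
  "slice S = {x \<in> Rn 1. x 0 \<in> S}"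

lemma enorm_1: "enorm (Suc 0) x = \<bar>x 0\<bar>"
  by (simp add: enorm_def L2_set_def lessThan_Suc)

lemma edist_1: "edist (Suc 0) x y = \<bar>x 0 - y 0\<bar>"
  by (simp add: edist_def enorm_1)

lemma space_lebesgue_Rn: "space (lebesgue_Rn n) = Rn n"
  by (simp add: lebesgue_Rn_def space_PiM Rn_def)

lemma lebesgue_Rn_1: "lebesgue_Rn 1 = completion (PiM {0} (\<lambda>_. lborel))"
proof -
  have "{..<1::nat} = {0}" by auto
  then show ?thesis unfolding lebesgue_Rn_def by metis
qed

lemma slice_sets:
  assumes "S \<in> sets borel"
  shows "slice S \<in> sets (lebesgue_Rn 1)"
proof -
  let ?M = "PiM {0::nat} (\<lambda>_. lborel :: real measure)"
  have "(\<lambda>x. x 0) -` S \<inter> space ?M \<in> sets ?M"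
    using assms by (intro measurable_sets[OF measurable_component_singleton]) simp_all
  moreover have "slice S = (\<lambda>x. x 0) -` S \<inter> space ?M"
    unfolding slice_def space_lebesgue_Rn[symmetric] lebesgue_Rn_1 space_completion by blast
  ultimately show ?thesis
    unfolding lebesgue_Rn_1 by (simp add: sets_completionI_sets)
qed

text \<open>Completion does not change nonnegative integrals, and a product measure with one factor
  integrates like that factor.\<close>

lemma nn_integral_slice:
  assumes [measurable]: "S \<in> sets borel" "f \<in> borel_measurable borel"
  shows "(\<integral>\<^sup>+x\<in>slice S. f (x 0) \<partial>lebesgue_Rn 1) = (\<integral>\<^sup>+t\<in>S. f t \<partial>lborel)"
proof -
  interpret product_sigma_finite "\<lambda>_::nat. lborel :: real measure"
    by standard
  have "(\<integral>\<^sup>+x\<in>slice S. f (x 0) \<partial>lebesgue_Rn 1) =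
      (\<integral>\<^sup>+x. f (x 0) * indicator S (x 0) \<partial>lebesgue_Rn 1)"
    by (intro nn_integral_cong) (auto simp: space_lebesgue_Rn slice_def indicator_def)
  also have "\<dots> = (\<integral>\<^sup>+x. f (x 0) * indicator S (x 0) \<partial>PiM {0::nat} (\<lambda>_. lborel))"
    unfolding lebesgue_Rn_1 by (rule nn_integral_completion)
  also have "\<dots> = (\<integral>\<^sup>+t\<in>S. f t \<partial>lborel)"
    by (subst product_nn_integral_singleton) auto
  finally show ?thesis .
qed

section \<open>Boundary regularity in dimension one\<close>

lemma Ck_on_const: "Ck_on n k U (\<lambda>_. c)"
  \<comment> \<open>The constant must vary in the induction, since the partial derivatives are the
    constant 0.\<close>
  by (induction k arbitrary: c) (auto simp: partial_deriv_def[abs_def])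

text \<open>A ball around a frontier point meets the set; if membership were constant on the ball,
  the ball would lie in the set and the point would be interior.\<close>

lemma slice_frontier_locally_nonconstant:
  assumes p: "p \<in> Rn.mtopology 1 frontier_of slice S" and r: "r > 0"
  shows "\<not> (\<forall>x. \<bar>x - p 0\<bar> < r \<longrightarrow> (x \<in> S \<longleftrightarrow> b))"
proof
  assume *: "\<forall>x. \<bar>x - p 0\<bar> < r \<longrightarrow> (x \<in> S \<longleftrightarrow> b)"
  have ball: "x 0 \<in> S \<longleftrightarrow> b" if "x \<in> Rn.mball 1 p r" for x
    using that * by (auto simp: edist_1 abs_minus_commute)
  obtain y where "y \<in> slice S" "y \<in> Rn.mball 1 p r"
    using p r by (auto simp: frontier_of_def Rn.metric_closure_of)
  then have b using ball by (auto simp: slice_def)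
  then have "Rn.mball 1 p r \<subseteq> slice S"
    using ball by (auto simp: slice_def)
  then have "p \<in> Rn.mtopology 1 interior_of slice S"
    using p r by (auto simp: Rn.in_interior_of_mball frontier_of_def Rn.metric_closure_of)
  then show False using p by (simp add: frontier_of_def)
qed

text \<open>In dimension one the graph function depends on no coordinate, so it is the constant
  \<open>p 0\<close>. Any regularity class that contains the constants is therefore reached.\<close>

lemma slice_has_boundary_of_class:
  assumes const: "\<And>U c. \<C> U (\<lambda>_. c)"
    and local: "\<And>p. (\<exists>r>0. \<exists>b. \<forall>x. \<bar>x - p\<bar> < r \<longrightarrow> (x \<in> S \<longleftrightarrow> b)) \<or>
      (\<exists>r>0. \<exists>\<sigma>\<in>{-1, 1}. \<forall>x. \<bar>x - p\<bar> < r \<longrightarrow>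
         (\<sigma> * (x - p) > 0 \<longrightarrow> x \<in> S) \<and> (\<sigma> * (x - p) < 0 \<longrightarrow> x \<notin> S))"
  shows "has_boundary_of_class 1 \<C> (slice S)"
  unfolding has_boundary_of_class_def
proof
  fix p assume p: "p \<in> Rn.mtopology 1 frontier_of slice S"
  then obtain r \<sigma> where r: "r > 0" "\<sigma> \<in> {-1, 1}"
    "\<And>x. \<bar>x - p 0\<bar> < r \<Longrightarrow> (\<sigma> * (x - p 0) > 0 \<longrightarrow> x \<in> S) \<and> (\<sigma> * (x - p 0) < 0 \<longrightarrow> x \<notin> S)"
    using local[of "p 0"] slice_frontier_locally_nonconstant by blast
  show "\<exists>r>0. \<exists>i<1. \<exists>\<sigma>\<in>{-1, 1}. \<exists>g. \<C> (Rn.mball 1 p r) g \<and>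
      (\<forall>x\<in>Rn 1. \<forall>t. g (x(i := t)) = g x) \<and>
      (\<forall>x\<in>Rn.mball 1 p r. (\<sigma> * (x i - g x) > 0 \<longrightarrow> x \<in> slice S) \<and>
        (\<sigma> * (x i - g x) < 0 \<longrightarrow> x \<notin> slice S))"
  proof (intro exI[of _ r] exI[of _ "0::nat"] exI[of _ "\<lambda>_. p 0"] conjI bexI[of _ \<sigma>])
    show "\<forall>x\<in>Rn.mball 1 p r. (\<sigma> * (x 0 - p 0) > 0 \<longrightarrow> x \<in> slice S) \<and>
        (\<sigma> * (x 0 - p 0) < 0 \<longrightarrow> x \<notin> slice S)"
      using r(3) by (auto simp: edist_1 slice_def abs_minus_commute)
  qed (use r const in auto)
qed

section \<open>Interaction of a distant point with the interval\<close>

lemma interaction_slice_interval_bounds: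
  fixes u s :: real
  assumes "2 \<le> u" "0 < s" "s \<le> 1" "x 0 = u"
  defines "W \<equiv> (\<integral>\<^sup>+y\<in>slice {-1<..<1}. ennreal (1 / edist 1 x y powr (real 1 + s)) \<partial>lebesgue_Rn 1)"
  shows "ennreal (1/2) * ennreal (1 / u powr (1 + s)) \<le> W"
    and "W \<le> ennreal 8 * ennreal (1 / u powr (1 + s))"
proof -
  have W: "W = (\<integral>\<^sup>+v\<in>{-1<..<1}. ennreal (1 / \<bar>u - v\<bar> powr (1 + s)) \<partial>lborel)"
    unfolding W_def using assms(4)
    by (subst nn_integral_slice[symmetric]) (auto simp: edist_1)
  have two: "2 powr (1 + s) \<le> 4"
    using powr_mono[of "1 + s" 2 "2::real"] assms by simp
  \<comment> \<open>The factor 2 is the length of the interval. Taking \<open>c\<close> as 1/4 and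
    as 4 gives the constants 1/2 and 8.\<close>
  have const: "(\<integral>\<^sup>+v\<in>{-1<..<1::real}. ennreal (c / u powr (1 + s)) \<partial>lborel) =
      ennreal (2 * c) * ennreal (1 / u powr (1 + s))" if "c \<ge> 0" for c
  proof -
    have "(\<integral>\<^sup>+v\<in>{-1<..<1::real}. ennreal (c / u powr (1 + s)) \<partial>lborel) = ennreal (c / u powr (1 + s)) * ennreal 2"
      by (subst nn_integral_cmult_indicator) auto
    also have "\<dots> = ennreal (2 * c) * ennreal (1 / u powr (1 + s))"
      using that by (simp add: mult.commute del: ennreal_numeral flip: ennreal_mult)
    finally show ?thesis .
  qed
  have "1/4 / u powr (1 + s) \<le> 1 / \<bar>u - v\<bar> powr (1 + s)" if "-1 < v" "v < 1" for v
  proof -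
    \<comment> \<open>As \<open>u \<ge> 2\<close> and \<open>v > -1\<close>, the distance is below
      \<open>u + 1\<close>, hence below \<open>2 * u\<close>.\<close>
    have "\<bar>u - v\<bar> powr (1 + s) \<le> (2 * u) powr (1 + s)"
      using that assms by (intro powr_mono2) auto
    also have "\<dots> \<le> 4 * u powr (1 + s)"
      using two assms by (simp add: powr_mult mult_right_mono)
    finally show ?thesis using that assms by (simp add: field_simps)
  qed
  then have "(\<integral>\<^sup>+v\<in>{-1<..<1::real}. ennreal (1/4 / u powr (1 + s)) \<partial>lborel) \<le> W"
    unfolding W by (auto intro!: nn_integral_mono ennreal_leI simp: indicator_def)
  then show "ennreal (1/2) * ennreal (1 / u powr (1 + s)) \<le> W"
    by (subst (asm) const) auto
  have "1 / \<bar>u - v\<bar> powr (1 + s) \<le> 4 / u powr (1 + s)" if "-1 < v" "v < 1" for v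
  proof -
    \<comment> \<open>As \<open>u \<ge> 2\<close> and \<open>v < 1\<close>, the distance exceeds
      \<open>u - 1\<close>, which is at least \<open>u / 2\<close>.\<close>
    have "u powr (1 + s) \<le> (2 * \<bar>u - v\<bar>) powr (1 + s)"
      using that assms by (intro powr_mono2) auto
    also have "\<dots> \<le> 4 * \<bar>u - v\<bar> powr (1 + s)"
      using two assms by (simp add: powr_mult mult_right_mono)
    finally show ?thesis using that assms by (simp add: field_simps)
  qed
  then have "W \<le> (\<integral>\<^sup>+v\<in>{-1<..<1::real}. ennreal (4 / u powr (1 + s)) \<partial>lborel)"
    unfolding W by (auto intro!: nn_integral_mono ennreal_leI simp: indicator_def)
  then show "W \<le> ennreal 8 * ennreal (1 / u powr (1 + s))"
    by (subst (asm) const) auto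
qed

section \<open>Admissibility of the two sets\<close>

lemma slice_interval_boundary: "has_C1_holder_boundary 1 \<gamma> (slice {-1<..<1})"
  unfolding has_C1_holder_boundary_def
proof (rule slice_has_boundary_of_class)
  show "C1_holder_on 1 \<gamma> U (\<lambda>_. c)" for U c
    using Ck_on_const[of 1 1 U c]
    by (auto simp: C1_holder_on_def partial_deriv_def intro!: exI[of _ 0])
  fix p :: real
  consider "\<bar>p\<bar> < 1" | "\<bar>p\<bar> > 1" | "p = 1" | "p = -1" by linarith
  then show "(\<exists>r>0. \<exists>b. \<forall>x. \<bar>x - p\<bar> < r \<longrightarrow> (x \<in> {-1<..<1} \<longleftrightarrow> b)) \<or>
      (\<exists>r>0. \<exists>\<sigma>\<in>{-1, 1}. \<forall>x. \<bar>x - p\<bar> < r \<longrightarrow>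
         (\<sigma> * (x - p) > 0 \<longrightarrow> x \<in> {-1<..<1}) \<and> (\<sigma> * (x - p) < 0 \<longrightarrow> x \<notin> {-1<..<1}))"
  proof cases
    case 1
    then show ?thesis by (intro disjI1 exI[of _ "1 - \<bar>p\<bar>"] exI[of _ True] conjI allI impI) auto
  next
    case 2
    then show ?thesis by (intro disjI1 exI[of _ "\<bar>p\<bar> - 1"] exI[of _ False] conjI allI impI) auto
  next
    case 3
    \<comment> \<open>Radius 1 keeps the other end point away; the interval lies to the left of 1,
      hence the orientation -1.\<close>
    then show ?thesis by (intro disjI2 exI[of _ 1] conjI bexI[of _ "-1"]) auto
  next
    case 4
    then show ?thesis by (intro disjI2 exI[of _ 1] conjI bexI[of _ 1]) auto
  qed
qed

lemma slice_lacunary_boundary: "has_smooth_boundary 1 (slice lacunary_set)"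
  unfolding has_smooth_boundary_def
proof (rule slice_has_boundary_of_class)
  show "smooth_fun_on 1 U (\<lambda>_. c)" for U c
    by (simp add: smooth_fun_on_def Ck_on_const)
  show "(\<exists>r>0. \<exists>b. \<forall>x. \<bar>x - p\<bar> < r \<longrightarrow> (x \<in> lacunary_set \<longleftrightarrow> b)) \<or>
      (\<exists>r>0. \<exists>\<sigma>\<in>{-1, 1}. \<forall>x. \<bar>x - p\<bar> < r \<longrightarrow>
         (\<sigma> * (x - p) > 0 \<longrightarrow> x \<in> lacunary_set) \<and> (\<sigma> * (x - p) < 0 \<longrightarrow> x \<notin> lacunary_set))" for p
  proof (cases rule: lacunary_set_local_structure[of p])
    case (locally_const r b)
    then show ?thesis by (intro disjI1 exI[of _ r] exI[of _ b] conjI) auto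
  next
    case (boundary r \<sigma>)
    then show ?thesis by (intro disjI2 exI[of _ r] bexI[of _ \<sigma>] conjI) auto
  qed
qed

lemma openin_slice_interval: "openin (Rn.mtopology 1) (slice {-1<..<1})"
  and mbounded_slice_interval: "Rn.mbounded 1 (slice {-1<..<1})"
proof -
  \<comment> \<open>The origin of \<open>Rn 1\<close> must be extensional, hence the restricted zero
    function. The slice is the unit ball around it.\<close>
  let ?o = "\<lambda>i\<in>{..<1::nat}. 0::real"
  have o: "?o \<in> Rn 1" by (auto simp: Rn_def)
  have "slice {-1<..<1} = Rn.mball 1 ?o 1"
    using o by (auto simp: edist_1 slice_def)
  then show "openin (Rn.mtopology 1) (slice {-1<..<1})" "Rn.mbounded 1 (slice {-1<..<1})"
    by simp_all
qed

section \<open>Tail integral and perimeter of the lacunary set\<close>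

lemma lacunary_mass_slice:
  "lacunary_mass s = ennreal s * (\<integral>\<^sup>+x\<in>slice lacunary_set. ennreal (1 / x 0 powr (1 + s)) \<partial>lebesgue_Rn 1)"
  unfolding lacunary_mass_def by (subst nn_integral_slice) auto

text \<open>The set lies beyond 2, so removing the unit ball changes nothing and the norm is the
  coordinate itself.\<close>

lemma lacunary_tail_integral:
  "ennreal s * (\<integral>\<^sup>+y\<in>slice lacunary_set \<inter> (Rn 1 - unit_ball 1). ennreal (1 / enorm 1 y powr (real 1 + s)) \<partial>lebesgue_Rn 1)
    = lacunary_mass s"
proof -
  have "slice lacunary_set \<inter> (Rn 1 - unit_ball 1) = slice lacunary_set"
    by (auto simp: slice_def unit_ball_def enorm_1 dest: lacunary_set_ge_2)
  then show ?thesis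
    unfolding lacunary_mass_slice
    by (auto intro!: arg_cong[where f = "(*) _"] nn_integral_cong
        simp: enorm_1 slice_def indicator_def abs_of_pos dest!: lacunary_set_ge_2)
qed

text \<open>The two sets are disjoint, so the first two of the three terms are integrals over the
  empty set.\<close>

lemma Per_lacunary:
  "Per 1 s (slice lacunary_set) (slice {-1<..<1}) = interaction 1 s (slice lacunary_set) (slice {-1<..<1})"
proof -
  have eqs: "slice lacunary_set \<inter> slice {-1<..<1} = {}"
    "slice lacunary_set \<inter> (Rn 1 - slice {-1<..<1}) = slice lacunary_set"
    "(Rn 1 - slice lacunary_set) \<inter> slice {-1<..<1} = slice {-1<..<1}"
    by (auto simp: slice_def dest: lacunary_set_ge_2)
  show ?thesis
    unfolding Per_def eqs by (simp add: interaction_def)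
qed

text \<open>The pointwise bounds on the inner integral over the interval are integrated over the
  lacunary set.\<close>

lemma Per_lacunary_comparable:
  assumes "0 < s" "s \<le> 1"
  defines "P \<equiv> ennreal s * Per 1 s (slice lacunary_set) (slice {-1<..<1})"
  shows "ennreal (1/2) * lacunary_mass s \<le> P" "P \<le> ennreal 8 * lacunary_mass s"
proof -
  have meas: "(\<lambda>x. ennreal (1 / x 0 powr (1 + s)) * indicator (slice lacunary_set) x) \<in> borel_measurable (lebesgue_Rn 1)"
  proof -
    have "(\<lambda>x. x 0) \<in> borel_measurable (lebesgue_Rn 1)"
      unfolding lebesgue_Rn_1 by (intro measurable_completion) simp
    moreover note slice_sets[OF lacunary_set_borel]
    ultimately show ?thesis by measurable
  qed
  \<comment> \<open>Moving the constant under the integral lets the two sides be compared integrand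
    by integrand.\<close>
  have scaled: "c * lacunary_mass s = ennreal s *
      (\<integral>\<^sup>+x. c * (ennreal (1 / x 0 powr (1 + s)) * indicator (slice lacunary_set) x) \<partial>lebesgue_Rn 1)" for c
    unfolding lacunary_mass_slice nn_integral_cmult[OF meas] by (simp add: mult_ac)
  note bounds = interaction_slice_interval_bounds[OF lacunary_set_ge_2 assms(1,2) refl]
  show "ennreal (1/2) * lacunary_mass s \<le> P"
    unfolding P_def Per_lacunary scaled interaction_def
    using bounds(1) by (intro mult_left_mono nn_integral_mono) (auto simp: indicator_def slice_def)
  show "P \<le> ennreal 8 * lacunary_mass s"
    unfolding P_def Per_lacunary scaled interaction_def
    using bounds(2) by (intro mult_left_mono nn_integral_mono) (auto simp: indicator_def slice_def)
qed

theorem mainTheorem7: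
  "\<exists>(n::nat) (\<gamma>::real) (\<Omega>::(nat \<Rightarrow> real) set) (E::(nat \<Rightarrow> real) set).
     n \<ge> 1 \<and>
     0 < \<gamma> \<and> \<gamma> < 1 \<and>
     openin (Rn.mtopology n) \<Omega> \<and> Rn.mbounded n \<Omega> \<and> has_C1_holder_boundary n \<gamma> \<Omega> \<and>
     E \<subseteq> Rn n \<and> E \<in> sets (lebesgue_Rn n) \<and> has_smooth_boundary n E \<and>
     \<not> (\<exists>l. ((\<lambda>s. ennreal s * Per n s E \<Omega>) \<longlongrightarrow> l) (at_right 0)) \<and>
     \<not> (\<exists>l. ((\<lambda>s. ennreal s *
            (\<integral>\<^sup>+y\<in>E \<inter> (Rn n - unit_ball n). ennreal (1 / enorm n y powr (real n + s)) \<partial>lebesgue_Rn n))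
            \<longlongrightarrow> l) (at_right 0))"
proof (intro exI conjI)
  \<comment> \<open>This fixes the dimension 1 and the exponent 1/2; the boundary lemma for the
    interval covers every exponent.\<close>
  show "0 < (1/2::real)" "(1/2::real) < 1" "1 \<le> (1::nat)" by auto
  show "slice lacunary_set \<subseteq> Rn 1" by (auto simp: slice_def)
  show "\<not> (\<exists>l. ((\<lambda>s. ennreal s * Per 1 s (slice lacunary_set) (slice {-1<..<1})) \<longlongrightarrow> l) (at_right 0))"
    by (intro not_convergent_if_comparable_lacunary_mass Per_lacunary_comparable)
  \<comment> \<open>The tail integral equals the mass, so it is comparable with factor 1, which lies
    between 1/2 and 8.\<close>
  have "ennreal (1/2) * lacunary_mass s \<le> 1 * lacunary_mass s"
    "1 * lacunary_mass s \<le> ennreal 8 * lacunary_mass s" for s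
    by (rule mult_right_mono; auto simp: ennreal_le_1 ennreal_ge_1 simp del: ennreal_half)+
  then show "\<not> (\<exists>l. ((\<lambda>s. ennreal s * (\<integral>\<^sup>+y\<in>slice lacunary_set \<inter> (Rn 1 - unit_ball 1).
      ennreal (1 / enorm 1 y powr (real 1 + s)) \<partial>lebesgue_Rn 1)) \<longlongrightarrow> l) (at_right 0))"
    unfolding lacunary_tail_integral mult_1 by (intro not_convergent_if_comparable_lacunary_mass)
qed (use openin_slice_interval mbounded_slice_interval slice_interval_boundary
      slice_sets[OF lacunary_set_borel] slice_lacunary_boundary in auto)

end
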